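(* Let $\tfrac12<\rho<1$, let $m\ge 1$ and $N=2^m$. Let $\mu=\mu_{\rho,m}$ be the probability measure on the integers $0\le n<N$ given as the law of $\sum_{j=0}^{m-1}\xi_j2^j$, where $\xi_0,\dots,\xi_{m-1}$ are independent with $\mathbb P[\xi_j=0]=\rho$, $\mathbb P[\xi_j=1]=1-\rho$; equivalently, if $n=\sum_j a_j2^j$ with $a_j\in\{0,1\}$ then $\mu(n)=\rho^{m-\ell}(1-\rho)^{\ell}$ with $\ell=\sum_j a_j$. For a positive integer $q$ define $$R_q=\frac1q\sum_{\lambda=1}^{q-1}\sum_{n}e\!\left(\frac{\lambda n}{q}\right)\mu(n)=\frac1q\sum_{\lambda=1}^{q-1}\prod_{j=0}^{m-1}\left(\rho+(1-\rho)\,e\!\left(\frac{\lambda 2^j}{q}\right)\right),$$ so that $\mu[\{n: q\mid n\}]=\frac1q+R_q$, where $e(\theta)=e^{2\pi i\theta}$. Then there exists $\alpha=\alpha(\rho)>0$ such that $$\sum_{\substack{q<N^{\alpha}\\ q \text{ odd, squarefree}}}|R_q|=o(1)\quad\text{as } m\to\infty.$$ Moreover, one can take $\alpha(\rho)$ of order $1-\rho$ as $\rho\to1$: there is an absolute constant $c>0$ such that $\alpha(\rho)=c(1-\rho)$ is admissible.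
   Context: A number $\alpha>0$ for which the displayed bound holds is called a sieving exponent (level of distribution) for $\mu$. *)

theory Defs
  imports
    "HOL-Probability.Probability"
    "HOL-Library.Landau_Symbols"
    "HOL-Computational_Algebra.Squarefree"
begin

definition e2pi :: "real \<Rightarrow> complex" where
  "e2pi \<theta> = exp (2 * of_real pi * \<i> * of_real \<theta>)"

(* The law of xi_0 + 2 xi_1 + ... + 2^(m-1) xi_(m-1); the bit xi_j is encoded as a truth value,
   and True has probability 1 - \<rho>. *)
definition \<mu> :: "real \<Rightarrow> nat \<Rightarrow> nat pmf" where
  "\<mu> \<rho> m = map_pmf (\<lambda>\<xi>. \<Sum>j<m. of_bool (\<xi> j) * 2 ^ j)
                 (Pi_pmf {..<m} False (\<lambda>_. bernoulli_pmf (1 - \<rho>)))"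

definition Rq :: "real \<Rightarrow> nat \<Rightarrow> nat \<Rightarrow> complex" where
  "Rq \<rho> m q = 1 / of_nat q *
     (\<Sum>l=1..q-1. \<Sum>n<2^m. e2pi (real l * real n / real q) * of_real (pmf (\<mu> \<rho> m) n))"

definition sieving_exponent :: "real \<Rightarrow> real \<Rightarrow> bool" where
  "sieving_exponent \<rho> \<alpha> \<longleftrightarrow> \<alpha> > 0 \<and>
     (\<lambda>m. \<Sum>q | real q < (2 ^ m) powr \<alpha> \<and> odd q \<and> squarefree q. cmod (Rq \<rho> m q)) \<in> o(\<lambda>_. 1)"

lemma \<mu>_0: "\<mu> \<rho> 0 = return_pmf 0"
  by (simp add: \<mu>_def)

lemma \<mu>_Suc:
  "\<mu> \<rho> (Suc m) = bernoulli_pmf (1 - \<rho>) \<bind> (\<lambda>b. map_pmf (\<lambda>n. n + of_bool b * 2 ^ m) (\<mu> \<rho> m))"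
proof -
  have "Pi_pmf {..<Suc m} False (\<lambda>_. bernoulli_pmf (1 - \<rho>)) =
     bernoulli_pmf (1 - \<rho>) \<bind> (\<lambda>b. map_pmf (\<lambda>f. f(m := b)) (Pi_pmf {..<m} False (\<lambda>_. bernoulli_pmf (1 - \<rho>))))"
    unfolding lessThan_Suc by (subst Pi_pmf_insert') (auto simp: map_pmf_def)
  then show ?thesis
    by (simp add: \<mu>_def map_bind_pmf pmf.map_comp o_def del: sum_of_bool_mult_eq sum_mult_of_bool_eq)
qed

lemma pmf_shift:
  fixes p :: "nat pmf"
  shows "pmf (map_pmf (\<lambda>n. n + c) p) n = (if c \<le> n then pmf p (n - c) else 0)"
proof (cases "c \<le> n")
  case True
  then have "pmf (map_pmf (\<lambda>n. n + c) p) ((\<lambda>n. n + c) (n - c)) = pmf p (n - c)"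
    by (intro pmf_map_inj') (auto simp: inj_def)
  with True show ?thesis by simp
qed (auto simp: pmf_eq_0_set_pmf)

lemma pmf_\<mu>_Suc:
  assumes "0 \<le> \<rho>" "\<rho> \<le> 1"
  shows "pmf (\<mu> \<rho> (Suc m)) n =
     \<rho> * pmf (\<mu> \<rho> m) n + (if 2 ^ m \<le> n then (1 - \<rho>) * pmf (\<mu> \<rho> m) (n - 2 ^ m) else 0)"
  using assms by (simp add: \<mu>_Suc pmf_bind pmf_shift pmf.map_ident)

lemma pmf_\<mu>_eq_0:
  assumes "0 \<le> \<rho>" "\<rho> \<le> 1" "2 ^ m \<le> n"
  shows "pmf (\<mu> \<rho> m) n = 0"
  using assms(3) by (induction m arbitrary: n) (auto simp: \<mu>_0 pmf_\<mu>_Suc assms)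

lemma binary_sum_less: "(\<Sum>j<m. of_bool (a j) * 2 ^ j) < (2 :: nat) ^ m"
  by (induction m) (auto simp: of_bool_def)

lemma pmf_\<mu>:
  fixes m :: nat
  assumes "0 \<le> \<rho>" "\<rho> \<le> 1"
  defines "L \<equiv> \<lambda>a. card {j. j < m \<and> a j}"
  shows "pmf (\<mu> \<rho> m) (\<Sum>j<m. of_bool (a j) * 2 ^ j) = \<rho> ^ (m - L a) * (1 - \<rho>) ^ L a"
proof -
  have 1: "pmf (\<mu> \<rho> m) (\<Sum>j<m. of_bool (a j) * 2 ^ j) = (\<Prod>j<m. if a j then 1 - \<rho> else \<rho>)"
  proof (induction m)
    case (Suc m)
    then show ?case
      using assms(1,2) binary_sum_less[of a m]
      by (auto simp: pmf_\<mu>_Suc pmf_\<mu>_eq_0 not_le simp del: sum_of_bool_mult_eq)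
  qed (simp add: \<mu>_0)
  have 2: "{..<m} \<inter> {j. a j} = {j. j < m \<and> a j}"
    by auto
  have "card ({..<m} \<inter> - {j. a j}) = m - card ({..<m} \<inter> {j. a j})"
    by (metis Diff_Compl card_Diff_subset_Int card_lessThan double_compl finite_Int finite_lessThan)
  then show ?thesis
    unfolding 1 L_def by (simp add: prod.If_cases 2 mult.commute)
qed

lemma sum_\<mu>_Suc:
  fixes f :: "nat \<Rightarrow> complex"
  assumes "0 \<le> \<rho>" "\<rho> \<le> 1"
  shows "(\<Sum>n<2^Suc m. f n * of_real (pmf (\<mu> \<rho> (Suc m)) n)) =
     of_real \<rho> * (\<Sum>n<2^m. f n * of_real (pmf (\<mu> \<rho> m) n)) +
     of_real (1 - \<rho>) * (\<Sum>n<2^m. f (n + 2^m) * of_real (pmf (\<mu> \<rho> m) n))"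
proof -
  have split: "(\<Sum>n<2^Suc m. g n) = (\<Sum>n<2^m. g n) + (\<Sum>n<2^m. g (n + 2^m))"
    for g :: "nat \<Rightarrow> complex"
  proof -
    have "(\<Sum>n=0..<2^Suc m. g n) = (\<Sum>n=0..<2^m. g n) + (\<Sum>n=2^m..<2^m + 2^m. g n)"
      by (simp add: sum.atLeastLessThan_concat mult_2)
    also have "(\<Sum>n=2^m..<2^m + 2^m. g n) = (\<Sum>n=0..<2^m. g (n + 2^m))"
      using sum.shift_bounds_nat_ivl[of g 0 "2^m" "2^m"] by simp
    finally show ?thesis by (simp add: lessThan_atLeast0)
  qed
  show ?thesis
    unfolding split sum_distrib_left
    by (intro arg_cong2[where f = "(+)"] sum.cong)
       (auto simp: pmf_\<mu>_Suc pmf_\<mu>_eq_0 assms)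
qed

lemma e2pi_add: "e2pi (x + y) = e2pi x * e2pi y"
  by (simp add: e2pi_def algebra_simps flip: exp_add)

lemma sum_e2pi_\<mu>:
  assumes "0 \<le> \<rho>" "\<rho> \<le> 1"
  shows "(\<Sum>n<2^m. e2pi (x * real n) * of_real (pmf (\<mu> \<rho> m) n)) =
     (\<Prod>j<m. of_real \<rho> + of_real (1 - \<rho>) * e2pi (x * 2 ^ j))"
proof (induction m)
  case 0
  then show ?case by (simp add: \<mu>_0 e2pi_def)
next
  case (Suc m)
  have "(\<Sum>n<2^m. e2pi (x * real (n + 2^m)) * of_real (pmf (\<mu> \<rho> m) n)) =
      e2pi (x * 2 ^ m) * (\<Sum>n<2^m. e2pi (x * real n) * of_real (pmf (\<mu> \<rho> m) n))"
    by (simp add: sum_distrib_left e2pi_add distrib_left mult_ac)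
  then show ?case
    unfolding sum_\<mu>_Suc[OF assms] prod.lessThan_Suc Suc.IH[symmetric]
    by (simp add: algebra_simps)
qed

lemma Rq_eq_prod:
  assumes "0 \<le> \<rho>" "\<rho> \<le> 1"
  shows "Rq \<rho> m q = 1 / of_nat q *
     (\<Sum>l=1..q-1. \<Prod>j<m. of_real \<rho> + of_real (1 - \<rho>) * e2pi (real l * 2 ^ j / real q))"
proof -
  have "(\<Sum>n<2^m. e2pi (real l * real n / real q) * of_real (pmf (\<mu> \<rho> m) n)) =
      (\<Prod>j<m. of_real \<rho> + of_real (1 - \<rho>) * e2pi (real l * 2 ^ j / real q))" for l
    using sum_e2pi_\<mu>[OF assms, where x = "real l / real q"] by simp
  then show ?thesis
    by (simp only: Rq_def)
qed

lemma sum_e2pi_orthogonality: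
  assumes "q > 0"
  shows "(\<Sum>l<q. e2pi (real l * real n / real q)) = (if q dvd n then of_nat q else 0)"
proof -
  define z where "z = e2pi (real n / real q)"
  have pow: "e2pi (real l * real n / real q) = z ^ l" for l
    by (simp add: z_def e2pi_def mult_ac flip: exp_of_nat_mult)
  have z1: "z = 1 \<longleftrightarrow> q dvd n"
  proof -
    have "z = 1 \<longleftrightarrow> (\<exists>k::int. real n / real q = of_int k)"
    proof -
      have "pi * (2 * real n) / real q = pi * (2 * of_int k) \<longleftrightarrow> real n / real q = of_int k" for k :: int
        using assms by (auto simp: field_simps)
      then show ?thesis
        by (simp add: z_def e2pi_def exp_eq_1 mult_ac)
    qed
    also have "\<dots> \<longleftrightarrow> (\<exists>k::int. int n = k * int q)"
    proof -
      have "real n / real q = of_int k \<longleftrightarrow> int n = k * int q" for k :: int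
      proof -
        have "real n / real q = of_int k \<longleftrightarrow> (of_int (int n) :: real) = of_int (k * int q)"
          using assms by (simp add: divide_eq_eq)
        then show ?thesis
          by (simp only: of_int_eq_iff)
      qed
      then show ?thesis by simp
    qed
    also have "\<dots> \<longleftrightarrow> q dvd n"
      by (metis dvd_def int_dvd_int_iff mult.commute)
    finally show ?thesis .
  qed
  have "z ^ q = e2pi (real n)"
    using pow[of q] assms by simp
  also have "\<dots> = 1"
    by (auto simp: e2pi_def exp_eq_1 intro: exI[of _ "int n"])
  finally have "z ^ q = 1" .
  then show ?thesis
    unfolding pow using z1 by (auto simp: sum_gp_strict)
qed

lemma prob_dvd_\<mu>:
  assumes "0 \<le> \<rho>" "\<rho> \<le> 1" "q > 0"
  shows "of_real (measure_pmf.prob (\<mu> \<rho> m) {n. q dvd n}) = 1 / of_nat q + Rq \<rho> m q"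
proof -
  let ?p = "\<lambda>n. of_real (pmf (\<mu> \<rho> m) n) :: complex"
  have supp: "set_pmf (\<mu> \<rho> m) \<subseteq> {..<2^m}"
  proof
    fix n assume "n \<in> set_pmf (\<mu> \<rho> m)"
    then show "n \<in> {..<2^m}"
      using pmf_\<mu>_eq_0[OF assms(1,2), of m n] by (cases "2 ^ m \<le> n") (auto simp: set_pmf_eq)
  qed
  have tot: "(\<Sum>n<2^m. ?p n) = 1"
    using supp by (simp add: sum_pmf_eq_1 flip: of_real_sum)
  have "measure_pmf.prob (\<mu> \<rho> m) {n. q dvd n} = measure_pmf.prob (\<mu> \<rho> m) {n\<in>{..<2^m}. q dvd n}"
    using supp by (intro measure_pmf.finite_measure_eq_AE) (auto simp: AE_measure_pmf_iff)
  also have "\<dots> = (\<Sum>n | n < 2^m \<and> q dvd n. pmf (\<mu> \<rho> m) n)"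
    by (simp add: measure_measure_pmf_finite)
  finally have "of_real (measure_pmf.prob (\<mu> \<rho> m) {n. q dvd n}) = (\<Sum>n | n < 2^m \<and> q dvd n. ?p n)"
    by simp
  also have "\<dots> = (\<Sum>n<2^m. if q dvd n then ?p n else 0)"
    by (subst sum.inter_filter[symmetric]) auto
  also have "\<dots> = (\<Sum>n<2^m. 1 / of_nat q * ((\<Sum>l<q. e2pi (real l * real n / real q)) * ?p n))"
    using assms(3) by (intro sum.cong) (auto simp: sum_e2pi_orthogonality)
  also have "\<dots> = 1 / of_nat q * (\<Sum>l<q. \<Sum>n<2^m. e2pi (real l * real n / real q) * ?p n)"
    by (subst sum.swap) (simp only: sum_distrib_left sum_distrib_right)
  also have "{..<q} = insert 0 {1..q-1}"
    using assms(3) by auto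
  also have "(\<Sum>l\<in>insert 0 {1..q-1}. \<Sum>n<2^m. e2pi (real l * real n / real q) * ?p n) =
      1 + (\<Sum>l=1..q-1. \<Sum>n<2^m. e2pi (real l * real n / real q) * ?p n)"
    by (subst sum.insert) (auto simp: tot e2pi_def)
  finally show ?thesis
    by (simp only: Rq_def distrib_left mult_1_right)
qed

end

theory Submission
  imports Defs "HOL-Number_Theory.Totient" "HOL-Library.Log_Nat" "HOL-Real_Asymp.Real_Asymp"
begin

text \<open>
  Put \<open>\<delta> = 1 - \<rho>\<close>. The \<open>j\<close>-th factor of the product is at most \<open>e\<^sup>-\<^sup>\<delta>\<^sup>/\<^sup>2\<close> in modulus whenever the binary
  digits \<open>j\<close> and \<open>j + 1\<close> of \<open>\<lambda> / q\<close> differ, and at most 1 always. Writing \<open>\<lambda> / q = a / d\<close> in lowest terms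
  costs only a harmonic sum, which is \<open>O(m)\<close>. For \<open>d\<close> between \<open>2\<^sup>t\<^sup>-\<^sup>1\<close> and \<open>2\<^sup>t\<close>, cut the product into \<open>k\<close>
  blocks of length \<open>2t\<close>. Since \<open>d\<close> is odd, multiplication by \<open>2\<close> permutes the reduced residues mod \<open>d\<close>, so by
  AM-GM the product may be replaced by the \<open>k\<close>-th power of its first block. Reduced fractions with
  denominators below \<open>2\<^sup>t\<close> differ in their first \<open>2t\<close> digits, and none of these digit strings is constant, so
  the sum over all these \<open>a / d\<close> is at most that of \<open>\<epsilon>\<close> to the number of digit changes over all nonconstant
  strings of length \<open>2t\<close>, which is \<open>2 ((1 + \<epsilon>)\<^sup>2\<^sup>t\<^sup>-\<^sup>1 - 1)\<close> with \<open>\<epsilon> = e\<^sup>-\<^sup>\<delta>\<^sup>k\<^sup>/\<^sup>2\<close>. As \<open>2\<^sup>t \<le> 2 N\<^sup>c\<^sup>\<delta>\<close>, the number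
  \<open>\<epsilon>\<close> is small and in fact \<open>O((t / \<delta>m)\<^sup>2)\<close>; after weighting with \<open>1 / d\<close> the sum over \<open>t\<close> converges and gives
  \<open>O(1 / (\<delta>m)\<^sup>2)\<close>.
\<close>

section \<open>Digit changes and the modulus of a single factor\<close>

text \<open>The condition says that the fractional part of \<open>x / d\<close> lies in \<open>[1/4, 3/4)\<close>, i.e. that its first two
  binary digits differ. Then the cosine of \<open>2 \<pi> x / d\<close> is nonpositive.\<close>

definition turn :: "real \<Rightarrow> nat \<Rightarrow> nat \<Rightarrow> real" where
  "turn \<beta> d x = (if 4 * x div d mod 4 \<in> {1, 2} then \<beta> else 1)"

text \<open>As \<open>4 * x div 4 = x\<close>, \<open>turn \<beta> 4 x\<close> compares the last two
  binary digits of \<open>x\<close>. So this is \<open>\<beta>\<close> to the number of digit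
  changes among the lowest \<open>L + 1\<close> digits of \<open>n\<close>.\<close>

definition turns :: "real \<Rightarrow> nat \<Rightarrow> nat \<Rightarrow> real" where
  "turns \<beta> L n = (\<Prod>i<L. turn \<beta> 4 (n div 2 ^ i))"

lemma turn_nonneg: "0 \<le> \<beta> \<Longrightarrow> 0 \<le> turn \<beta> d x"
  and turn_le_1: "\<beta> \<le> 1 \<Longrightarrow> turn \<beta> d x \<le> 1"
  by (auto simp: turn_def)

lemma turn_power: "turn \<beta> d x ^ k = turn (\<beta> ^ k) d x"
  by (simp add: turn_def)

lemma turn_mod:
  assumes "d > 0"
  shows "turn \<beta> d (x mod d) = turn \<beta> d x"
proof -
  have "4 * x div d = 4 * (x mod d) div d + 4 * (x div d)"
  proof -
    have "4 * x = 4 * (x mod d) + d * (4 * (x div d))"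
      using mult_div_mod_eq[of d x] by (metis distrib_left mult.left_commute add.commute)
    then show ?thesis
      using assms by (metis div_mult_self2 less_not_refl add.commute)
  qed
  then show ?thesis
    by (simp add: turn_def)
qed

lemma cmod_factor_le_1:
  assumes "0 \<le> \<rho>" "\<rho> \<le> 1"
  shows "cmod (of_real \<rho> + of_real (1 - \<rho>) * e2pi x) \<le> 1"
proof -
  have "cmod (of_real \<rho> + of_real (1 - \<rho>) * e2pi x) \<le> cmod (of_real \<rho>) + cmod (of_real (1 - \<rho>) * e2pi x)"
    by (rule norm_triangle_ineq)
  also have "\<dots> = 1"
    using assms by (simp add: norm_mult e2pi_def del: of_real_diff)
  finally show ?thesis .
qed

text \<open>When the cosine is nonpositive, the squared modulus is at most
  \<open>\<rho>\<^sup>2 + (1 - \<rho>)\<^sup>2\<close>. This is at most \<open>\<rho>\<close>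
  because \<open>\<rho> \<ge> 1/2\<close>, and
  \<open>\<rho> \<le> exp (- (1 - \<rho>))\<close>.\<close>

lemma cmod_factor_le_turn:
  assumes "1/2 \<le> \<rho>" "\<rho> \<le> 1" "d > 0"
  shows "cmod (of_real \<rho> + of_real (1 - \<rho>) * e2pi (real x / real d)) \<le> turn (exp (- (1 - \<rho>) / 2)) d x"
proof (cases "4 * x div d mod 4 \<in> {1, 2}")
  case True
  define t where "t = 2 * pi * (real x / real d)"
  \<comment> \<open>\<open>v\<close> is the integer part of \<open>x / d\<close>, and
    \<open>y\<close> below is the fractional part.\<close>
  define v where "v = 4 * x div d div 4"
  define y where "y = real x / real d - real v"
  have block: "4 * (u div 4) + 1 \<le> u \<and> u < 4 * (u div 4) + 3" if "u mod 4 \<in> {1, 2}" for u :: nat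
  proof -
    from that have "u mod 4 = 1 \<or> u mod 4 = 2" by simp
    then show ?thesis by presburger
  qed
  have "4 * v + 1 \<le> 4 * x div d" "4 * x div d < 4 * v + 3"
    using block[OF True] unfolding v_def by simp_all
  then have "(4 * v + 1) * d \<le> 4 * x" "4 * x < (4 * v + 3) * d"
    using assms(3) by (simp_all add: less_eq_div_iff_mult_less_eq div_less_iff_less_mult)
  then have "real ((4 * v + 1) * d) \<le> real (4 * x)" "real (4 * x) < real ((4 * v + 3) * d)"
    by linarith+
  then have y: "1/4 \<le> y" "y \<le> 3/4"
    using assms(3) by (auto simp: y_def field_simps)
  have "t = 2 * pi * y + 2 * pi * real v"
    by (simp add: t_def y_def algebra_simps)
  then have "cos t = cos (2 * pi * y)"
    by (simp add: cos_add sin_integer_2pi cos_integer_2pi)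
  also have "\<dots> = - cos (2 * pi * y - pi)"
    by (simp add: cos_diff)
  also have "\<dots> \<le> 0"
    unfolding neg_le_0_iff_le
  proof (rule cos_ge_zero)
    have "pi * (1/4) \<le> pi * y" "pi * y \<le> pi * (3/4)"
      using y by (intro mult_left_mono; simp)+
    then show "- (pi / 2) \<le> 2 * pi * y - pi" "2 * pi * y - pi \<le> pi / 2"
      by linarith+
  qed
  finally have cos: "cos t \<le> 0" .
  have e: "e2pi (real x / real d) = cis t"
    unfolding e2pi_def cis_conv_exp t_def by (simp add: mult_ac)
  have "(cmod (of_real \<rho> + of_real (1 - \<rho>) * e2pi (real x / real d)))\<^sup>2
      = (\<rho> + (1 - \<rho>) * cos t)\<^sup>2 + ((1 - \<rho>) * sin t)\<^sup>2"
    unfolding e cmod_power2 by simp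
  also have "\<dots> = \<rho>\<^sup>2 + (1 - \<rho>)\<^sup>2 * ((sin t)\<^sup>2 + (cos t)\<^sup>2) + 2 * (\<rho> * (1 - \<rho>)) * cos t"
    by (simp only: power2_eq_square) algebra
  also have "\<dots> \<le> \<rho>\<^sup>2 + (1 - \<rho>)\<^sup>2"
    using assms cos by (simp add: mult_nonneg_nonpos)
  also have "\<dots> \<le> 1 - (1 - \<rho>)"
  proof -
    have "0 \<le> (2 * \<rho> - 1) * (1 - \<rho>)"
      using assms by (intro mult_nonneg_nonneg) auto
    then show ?thesis
      by (simp add: power2_eq_square algebra_simps)
  qed
  also have "\<dots> \<le> exp (- (1 - \<rho>))"
    using exp_ge_add_one_self[of "- (1 - \<rho>)"] by simp
  also have "\<dots> = (exp (- (1 - \<rho>) / 2))\<^sup>2"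
    by (simp add: power2_eq_square flip: exp_add)
  finally show ?thesis
    using True by (auto simp: turn_def intro: power2_le_imp_le)
next
  case False
  then show ?thesis
    using cmod_factor_le_1[of \<rho>] assms by (auto simp: turn_def)
qed

section \<open>Counting binary strings by their digit changes\<close>

lemma turns_0: "turns \<beta> L 0 = 1"
  by (simp add: turns_def turn_def)

lemma turns_Suc: "b < 2 \<Longrightarrow> turns \<beta> (Suc L) (2 * n + b) = turn \<beta> 4 (2 * n + b) * turns \<beta> L n"
proof -
  assume "b < 2"
  have "(2 * n + b) div 2 ^ Suc i = n div 2 ^ i" for i
    using \<open>b < 2\<close> by (simp add: div_mult2_eq)
  then show ?thesis
    unfolding turns_def prod.lessThan_Suc_shift by simp
qed

text \<open>The number \<open>2 ^ Suc L - 1\<close> is the string of \<open>L + 1\<close> ones,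
  which has no digit change.\<close>

lemma turns_ones: "turns \<beta> L (2 ^ Suc L - 1) = 1"
proof (induction L)
  case (Suc L)
  have "(1::nat) \<le> 2 ^ L" by simp
  then have eq: "2 ^ Suc (Suc L) - 1 = 2 * (2 ^ Suc L - 1) + (1::nat)"
    and "2 * (2 ^ Suc L - 1) + 1 = 4 * (2 ^ L - 1) + (3::nat)"
    unfolding power_Suc by linarith+
  then have "turn \<beta> 4 (2 * (2 ^ Suc L - 1) + 1) = 1"
    by (simp add: turn_def)
  then show ?case
    unfolding eq using Suc turns_Suc[of 1 \<beta> L "2 ^ Suc L - 1"] by simp
qed (simp add: turns_def)

text \<open>The first digit is free, whence the factor 2. Each further digit repeats its
  predecessor, with weight 1, or differs from it, with weight \<open>\<beta>\<close>.\<close>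

lemma sum_turns: "(\<Sum>n<2^Suc L. turns \<beta> L n) = 2 * (1 + \<beta>) ^ L"
proof (induction L)
  case (Suc L)
  have "(\<Sum>n<2^Suc (Suc L). turns \<beta> (Suc L) n) = (\<Sum>n<2^Suc L. \<Sum>b\<in>{n*2..<n*2+2}. turns \<beta> (Suc L) b)"
    unfolding sum.nat_group by (simp add: mult.commute)
  also have "\<dots> = (\<Sum>n<2^Suc L. (1 + \<beta>) * turns \<beta> L n)"
  proof (intro sum.cong refl)
    fix n
    have "(\<Sum>b\<in>{n*2..<n*2+2}. turns \<beta> (Suc L) b) = turns \<beta> (Suc L) (2 * n + 0) + turns \<beta> (Suc L) (2 * n + 1)"
      by (simp add: numeral_2_eq_2 mult.commute)
    also have "\<dots> = (turn \<beta> 4 (2 * n) + turn \<beta> 4 (2 * n + 1)) * turns \<beta> L n"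
      using turns_Suc[of 0 \<beta> L n] turns_Suc[of 1 \<beta> L n] by (simp add: algebra_simps)
    also have "turn \<beta> 4 (2 * n) + turn \<beta> 4 (2 * n + 1) = 1 + \<beta>"
    proof -
      have "2 * n mod 4 = 0 \<and> (2 * n + 1) mod 4 = 1 \<or> 2 * n mod 4 = 2 \<and> (2 * n + 1) mod 4 = 3"
        by presburger
      then show ?thesis
        by (auto simp: turn_def)
    qed
    finally show "(\<Sum>b\<in>{n*2..<n*2+2}. turns \<beta> (Suc L) b) = (1 + \<beta>) * turns \<beta> L n" .
  qed
  finally show ?case
    unfolding sum_distrib_left[symmetric] Suc by simp
qed (simp add: turns_def numeral_2_eq_2)

text \<open>The two excluded ends are the constant strings, each of weight 1. Leaving them out makes
  the sum small when \<open>\<beta>\<close> is small.\<close>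

lemma sum_turns_nonconst:
  "(\<Sum>n\<in>{0<..<2^Suc L - 1}. turns \<beta> L n) = 2 * ((1 + \<beta>) ^ L - 1)"
proof -
  have "(1::nat) < 2 ^ Suc L" by (rule one_less_power) auto
  then have "{..<2^Suc L} = insert 0 (insert (2^Suc L - 1) {0<..<2^Suc L - 1 :: nat})"
    by auto
  then have "(\<Sum>n<2^Suc L. turns \<beta> L n) = 1 + (1 + (\<Sum>n\<in>{0<..<2^Suc L - 1}. turns \<beta> L n))"
    using \<open>1 < 2 ^ Suc L\<close> by (simp only:) (subst sum.insert; simp add: turns_0 turns_ones[simplified])
  then show ?thesis
    unfolding sum_turns by simp
qed

section \<open>Averaging over the orbits of doubling\<close>

lemma prod_le_mean_power:
  fixes x :: "nat \<Rightarrow> real"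
  assumes "k > 0" "\<And>i. i < k \<Longrightarrow> 0 \<le> x i"
  shows "(\<Prod>i<k. x i) \<le> (\<Sum>i<k. x i ^ k) / k"
proof -
  \<comment> \<open>This exhibits the product as the geometric mean of the numbers
    \<open>x i ^ k\<close>.\<close>
  have "(\<Prod>i<k. x i) = ((\<Prod>i<k. x i) ^ k) powr (1 / k)"
  proof (cases "(\<Prod>i<k. x i) = 0")
    case False
    moreover have "(\<Prod>i<k. x i) \<ge> 0"
      using assms(2) by (intro prod_nonneg) auto
    ultimately have "(\<Prod>i<k. x i) > 0"
      by linarith
    then show ?thesis
      using assms(1) by (simp add: powr_realpow[symmetric] powr_powr)
  next
    case True
    show ?thesis
      unfolding True using assms(1) by simp
  qed
  also have "\<dots> = (\<Prod>i<k. x i ^ k) powr (1 / card {..<k})"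
    by (simp add: prod_power_distrib)
  also have "\<dots> \<le> (\<Sum>i<k. x i ^ k / card {..<k})"
    using assms by (intro arith_geom_mean) auto
  finally show ?thesis
    by (simp add: sum_divide_distrib)
qed

text \<open>Multiplication by a unit permutes the reduced residues. For \<open>d = 1\<close> the
  only totative is 1, while \<open>a * c mod 1\<close> is 0; hence \<open>d > 1\<close>.\<close>

lemma sum_totatives_mult_mod:
  fixes f :: "nat \<Rightarrow> 'a :: comm_monoid_add"
  assumes "d > 1" "coprime c d"
  shows "(\<Sum>a\<in>totatives d. f (a * c mod d)) = (\<Sum>a\<in>totatives d. f a)"
proof -
  let ?g = "\<lambda>a. a * c mod d"
  have inj: "inj_on ?g (totatives d)"
  proof
    fix a b assume ab: "a \<in> totatives d" "b \<in> totatives d" "?g a = ?g b"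
    then have "[a = b] (mod d)"
      using assms(2) by (simp add: cong_def[symmetric] cong_mult_rcancel_nat)
    with ab assms(1) show "a = b"
      by (auto simp: cong_def dest!: totatives_less)
  qed
  have "?g ` totatives d \<subseteq> totatives d"
  proof safe
    fix a assume a: "a \<in> totatives d"
    have cop: "coprime (?g a) d"
      using a assms by (simp add: in_totatives_iff)
    with assms(1) have "?g a > 0"
      by (metis coprime_0_left_iff gr_zeroI less_irrefl nat_dvd_1_iff_1)
    with cop show "?g a \<in> totatives d"
      using assms(1) by (auto simp: in_totatives_iff intro!: less_imp_le)
  qed
  with inj have "bij_betw ?g (totatives d) (totatives d)"
    by (simp add: bij_betw_def endo_inj_surj)
  then show ?thesis
    by (rule sum.reindex_bij_betw)
qed

text \<open>Block \<open>i\<close> of the product is the first block for the residue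
  \<open>a * 2 ^ (i * Suc L)\<close>. AM-GM bounds the product by the mean of the
  \<open>k\<close>-th powers of the blocks, and since \<open>d\<close> is odd these all have the
  same sum over \<open>a\<close>.\<close>

lemma sum_orbit_le_sum_block:
  assumes "d > 1" "odd d" "0 \<le> \<beta>" "\<beta> \<le> 1" "k > 0" "k * Suc L \<le> m"
  shows "(\<Sum>a\<in>totatives d. \<Prod>j<m. turn \<beta> d (a * 2 ^ j))
       \<le> (\<Sum>a\<in>totatives d. \<Prod>j<L. turn (\<beta> ^ k) d (a * 2 ^ j))"
proof -
  define G where "G a = (\<Prod>j<L. turn \<beta> d (a * 2 ^ j))" for a
  have G_nonneg: "0 \<le> G a" for a
    using assms by (auto simp: G_def intro!: prod_nonneg turn_nonneg)
  have G_mod: "G (a mod d) = G a" for a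
    unfolding G_def using assms(1)
    by (intro prod.cong refl) (metis (no_types) mod_mult_left_eq turn_mod less_trans zero_less_one)
  have "(\<Prod>j<m. turn \<beta> d (a * 2 ^ j)) \<le> (\<Sum>i<k. G (a * 2 ^ (i * Suc L) mod d) ^ k) / k" for a
  proof -
    have "(\<Prod>j<m. turn \<beta> d (a * 2 ^ j)) \<le> (\<Prod>j<k * Suc L. turn \<beta> d (a * 2 ^ j))"
    proof -
      have "(\<Prod>j<m. turn \<beta> d (a * 2 ^ j)) =
          (\<Prod>j<k * Suc L. turn \<beta> d (a * 2 ^ j)) * (\<Prod>j\<in>{k * Suc L..<m}. turn \<beta> d (a * 2 ^ j))"
        using assms(6) by (subst prod.union_disjoint[symmetric]) (auto intro!: prod.cong)
      also have "\<dots> \<le> (\<Prod>j<k * Suc L. turn \<beta> d (a * 2 ^ j)) * 1"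
        using assms by (intro mult_left_mono prod_le_1 prod_nonneg) (auto simp: turn_nonneg turn_le_1)
      finally show ?thesis by simp
    qed
    also have "\<dots> = (\<Prod>i<k. \<Prod>j\<in>{i * Suc L..<i * Suc L + Suc L}. turn \<beta> d (a * 2 ^ j))"
      by (rule prod.nat_group[symmetric])
    also have "\<dots> \<le> (\<Prod>i<k. G (a * 2 ^ (i * Suc L)))"
    proof (intro prod_mono conjI prod_nonneg ballI)
      fix i
      have shift: "(\<Prod>j\<in>{i * B..<i * B + B}. f j) = (\<Prod>j<B. f (i * B + j))" for f :: "nat \<Rightarrow> real" and i B
        using prod.shift_bounds_nat_ivl[of f 0 "i * B" B] by (simp add: lessThan_atLeast0 add.commute)
      have "(\<Prod>j\<in>{i * Suc L..<i * Suc L + Suc L}. turn \<beta> d (a * 2 ^ j))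
          = (\<Prod>j<Suc L. turn \<beta> d (a * 2 ^ (i * Suc L) * 2 ^ j))"
        using shift[of "\<lambda>j. turn \<beta> d (a * 2 ^ j)" i "Suc L"] by (simp only: power_add mult_ac)
      also have "\<dots> = G (a * 2 ^ (i * Suc L)) * turn \<beta> d (a * 2 ^ (i * Suc L) * 2 ^ L)"
        by (simp add: G_def)
      \<comment> \<open>The last factor of each block is dropped, since \<open>Suc L\<close> digits
        have only \<open>L\<close> adjacent pairs.\<close>
      also have "\<dots> \<le> G (a * 2 ^ (i * Suc L)) * 1"
        using assms G_nonneg by (intro mult_left_mono turn_le_1) auto
      finally show "(\<Prod>j\<in>{i * Suc L..<i * Suc L + Suc L}. turn \<beta> d (a * 2 ^ j)) \<le> G (a * 2 ^ (i * Suc L))"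
        by simp
    qed (use assms turn_nonneg in auto)
    also have "\<dots> \<le> (\<Sum>i<k. G (a * 2 ^ (i * Suc L)) ^ k) / k"
      using assms(5) G_nonneg by (intro prod_le_mean_power)
    finally show ?thesis
      unfolding G_mod .
  qed
  then have "(\<Sum>a\<in>totatives d. \<Prod>j<m. turn \<beta> d (a * 2 ^ j))
      \<le> (\<Sum>a\<in>totatives d. (\<Sum>i<k. G (a * 2 ^ (i * Suc L) mod d) ^ k) / k)"
    by (intro sum_mono)
  also have "\<dots> = (\<Sum>i<k. \<Sum>a\<in>totatives d. G (a * 2 ^ (i * Suc L) mod d) ^ k) / k"
    by (subst sum.swap) (simp add: sum_divide_distrib)
  also have "\<dots> = (\<Sum>i<k. \<Sum>a\<in>totatives d. G a ^ k) / k"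
    using assms(1,2) by (simp add: sum_totatives_mult_mod[where f = "\<lambda>a. G a ^ k"])
  also have "\<dots> = (\<Sum>a\<in>totatives d. G a ^ k)"
    using assms(5) by simp
  also have "\<dots> = (\<Sum>a\<in>totatives d. \<Prod>j<L. turn (\<beta> ^ k) d (a * 2 ^ j))"
    by (simp add: G_def prod_power_distrib turn_power)
  finally show ?thesis .
qed

section \<open>Binary expansions of reduced fractions\<close>

lemma turns_floor:
  assumes "d > 0"
  shows "turns \<beta> L (2 ^ Suc L * a div d) = (\<Prod>j<L. turn \<beta> d (a * 2 ^ j))"
proof -
  \<comment> \<open>The order is reversed: \<open>turns\<close> counts from the lowest digit,
    \<open>j\<close> from the binary point. Cutting off the last \<open>L - Suc j\<close> digits
    leaves \<open>4 * (a * 2 ^ j) div d\<close>.\<close>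
  have "turns \<beta> L (2 ^ Suc L * a div d) = (\<Prod>j<L. turn \<beta> 4 (2 ^ Suc L * a div d div 2 ^ (L - Suc j)))"
    unfolding turns_def by (rule prod.nat_diff_reindex[symmetric])
  also have "\<dots> = (\<Prod>j<L. turn \<beta> d (a * 2 ^ j))"
  proof (intro prod.cong refl)
    fix j assume j: "j \<in> {..<L}"
    have "Suc L = (L - Suc j) + (j + 2)" using j by auto
    then have "2 ^ Suc L * a = (4 * (a * 2 ^ j)) * 2 ^ (L - Suc j)"
      by (simp only: power_add) simp
    then have "2 ^ Suc L * a div d div 2 ^ (L - Suc j) = 4 * (a * 2 ^ j) div d"
      by (simp only: div_mult2_eq[symmetric] div_mult_mult2 power_not_zero) simp
    then show "turn \<beta> 4 (2 ^ Suc L * a div d div 2 ^ (L - Suc j)) = turn \<beta> d (a * 2 ^ j)"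
      by (simp add: turn_def)
  qed
  finally show ?thesis .
qed

text \<open>Distinct reduced fractions with denominators below \<open>2\<^sup>t\<close> differ by more than \<open>2\<^sup>-\<^sup>2\<^sup>t\<close>, so their
  first \<open>2t\<close> binary digits differ.\<close>

lemma inj_on_floor_fractions:
  fixes t :: nat
  assumes "D \<subseteq> {1<..<2 ^ t}"
  shows "inj_on (\<lambda>(d, a). 2 ^ (2 * t) * a div d) (Sigma D totatives)"
proof (rule inj_onI; clarify)
  fix d a d' a' :: nat
  assume D: "d \<in> D" "d' \<in> D" and a: "a \<in> totatives d" "a' \<in> totatives d'"
    and eq: "2 ^ (2 * t) * a div d = 2 ^ (2 * t) * a' div d'"
  have pos: "d > 0" "d' > 0" and lt: "d * d' < 2 ^ t * 2 ^ t"
    using D assms by (auto intro!: mult_strict_mono)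
  \<comment> \<open>If \<open>a / d > a' / d'\<close>, the gap is at least
    \<open>1 / (d * d')\<close>, so after scaling by \<open>2 ^ (2 * t)\<close> it exceeds 1 and the
    floors differ. The claim is stated for arbitrary pairs in order to be used in both
    directions.\<close>
  have le: "a * d' \<le> a' * d"
    if eq: "2 ^ (2 * t) * a div d = 2 ^ (2 * t) * a' div d'" and "d > 0" "d' > 0" "d * d' < 2 ^ t * 2 ^ t"
    for a a' d d' :: nat
  proof (rule ccontr)
    assume "\<not> a * d' \<le> a' * d"
    then have "a' * d + 1 \<le> a * d'" by simp
    define n where "n = 2 ^ (2 * t) * a' div d'"
    have 1: "n * d' \<le> 2 ^ (2 * t) * a'"
      by (simp add: n_def)
    have "2 ^ (2 * t) * a < (n + 1) * d"
      using that unfolding n_def by (metis add.commute div_less_iff_less_mult less_add_one)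
    then have "2 ^ (2 * t) * a * d' < (n + 1) * d * d'"
      using \<open>d' > 0\<close> by simp
    also have "\<dots> = n * d' * d + d * d'" by (simp add: algebra_simps)
    also have "\<dots> \<le> 2 ^ (2 * t) * a' * d + 2 ^ (2 * t)"
      using 1 that(4) by (intro add_mono mult_right_mono) (auto simp: mult_2 power_add)
    also have "\<dots> = 2 ^ (2 * t) * (a' * d + 1)" by (simp add: algebra_simps)
    also have "\<dots> \<le> 2 ^ (2 * t) * (a * d')"
      using \<open>a' * d + 1 \<le> a * d'\<close> by (intro mult_left_mono) auto
    finally show False by (simp add: mult.assoc)
  qed
  have "a * d' = a' * d"
    using le[OF eq pos lt] le[OF eq[symmetric] pos(2,1)] lt by (simp add: mult.commute)
  then show "d = d' \<and> a = a'"
    using a pos coprime_crossproduct_nat[of a d a' d'] by (auto simp: in_totatives_iff mult.commute)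
qed

text \<open>By injectivity the left side is a sum over distinct strings. None is constant, because
  \<open>a / d\<close> has distance at least \<open>1 / d > 1 / 2 ^ Suc L\<close> from both 0 and
  1.\<close>

lemma sum_turns_fractions_le:
  fixes t L :: nat
  assumes "D \<subseteq> {1<..<2 ^ t}" "Suc L = 2 * t" "0 \<le> \<beta>"
  shows "(\<Sum>d\<in>D. \<Sum>a\<in>totatives d. \<Prod>j<L. turn \<beta> d (a * 2 ^ j)) \<le> 2 * ((1 + \<beta>) ^ L - 1)"
proof -
  let ?h = "\<lambda>(d, a). 2 ^ Suc L * a div d :: nat"
  have fin: "finite D" using assms(1) finite_subset by blast
  have "(\<Sum>d\<in>D. \<Sum>a\<in>totatives d. \<Prod>j<L. turn \<beta> d (a * 2 ^ j))
      = (\<Sum>d\<in>D. \<Sum>a\<in>totatives d. turns \<beta> L (?h (d, a)))"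
    using assms(1) by (intro sum.cong refl) (auto simp: turns_floor simp del: power_Suc)
  also have "\<dots> = (\<Sum>p\<in>Sigma D totatives. turns \<beta> L (?h p))"
    using fin by (subst sum.Sigma) (auto simp: case_prod_beta)
  also have "\<dots> = (\<Sum>n\<in>?h ` Sigma D totatives. turns \<beta> L n)"
    using inj_on_floor_fractions[OF assms(1)] unfolding assms(2)[symmetric]
    by (subst sum.reindex) (auto simp: o_def)
  also have "\<dots> \<le> (\<Sum>n\<in>{0<..<2^Suc L - 1}. turns \<beta> L n)"
  proof (intro sum_mono2)
    show "?h ` Sigma D totatives \<subseteq> {0<..<2^Suc L - 1}"
    proof clarify
      fix d a assume da: "d \<in> D" "a \<in> totatives d"
      have t: "(2::nat) ^ t \<le> 2 ^ Suc L" using assms(2) by (intro power_increasing) auto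
      have d: "1 < d" "d < 2 ^ Suc L" using da assms(1) t by auto
      have a: "0 < a" "a < d" using da d totatives_less[of a d] by (auto simp: in_totatives_iff)
      have "d \<le> 2 ^ Suc L * a" using a d by (metis One_nat_def Suc_leI less_imp_le mult.right_neutral mult_le_mono)
      then have 1: "0 < 2 ^ Suc L * a div d"
        using d by (simp add: div_greater_zero_iff del: power_Suc)
      have "2 ^ Suc L * a + 2 ^ Suc L \<le> 2 ^ Suc L * d"
        using a by (metis Suc_leI mult_Suc_right mult_le_mono2 add.commute)
      moreover have "2 ^ Suc L * d = (2 ^ Suc L - 1) * d + d"
        using d by (metis One_nat_def Suc_diff_1 add.commute mult_Suc zero_less_numeral zero_less_power)
      ultimately have "2 ^ Suc L * a < (2 ^ Suc L - 1) * d"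
        using d(2) by linarith
      then have "2 ^ Suc L * a div d < 2 ^ Suc L - 1"
        using d by (subst div_less_iff_less_mult) auto
      with 1 show "2 ^ Suc L * a div d \<in> {0<..<2 ^ Suc L - 1}" by simp
    qed
  qed (use assms(3) in \<open>auto simp: turns_def intro!: prod_nonneg turn_nonneg\<close>)
  also have "\<dots> = 2 * ((1 + \<beta>) ^ L - 1)"
    by (rule sum_turns_nonconst)
  finally show ?thesis .
qed

section \<open>From \<open>Rq\<close> to sums over reduced fractions\<close>

lemma cmod_Rq_le:
  assumes "1/2 \<le> \<rho>" "\<rho> \<le> 1" "q > 0"
  shows "cmod (Rq \<rho> m q) \<le> 1 / q * (\<Sum>l=1..q-1. \<Prod>j<m. turn (exp (- (1 - \<rho>) / 2)) q (l * 2 ^ j))"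
proof -
  have "cmod (Rq \<rho> m q) = 1 / q *
     cmod (\<Sum>l=1..q-1. \<Prod>j<m. of_real \<rho> + of_real (1 - \<rho>) * e2pi (real (l * 2 ^ j) / real q))"
    using assms by (simp add: Rq_eq_prod norm_mult norm_divide del: of_real_diff)
  also have "\<dots> \<le> 1 / q * (\<Sum>l=1..q-1. \<Prod>j<m. turn (exp (- (1 - \<rho>) / 2)) q (l * 2 ^ j))"
    unfolding prod_norm[symmetric]
    by (intro mult_left_mono order.trans[OF norm_sum] sum_mono order.trans[OF eq_refl[OF prod_norm[symmetric]]]
        prod_mono conjI norm_ge_zero cmod_factor_le_turn assms) auto
  finally show ?thesis .
qed

text \<open>Every \<open>l / q\<close> is \<open>(k a) / (k d)\<close> with \<open>a / d\<close> reduced and \<open>k, d\<close> dividing \<open>q\<close>.\<close>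

lemma sum_fractions_le_sum_reduced:
  fixes f :: "nat \<Rightarrow> nat \<Rightarrow> real"
  assumes "finite A" and A: "\<And>q d. q \<in> A \<Longrightarrow> d dvd q \<Longrightarrow> d \<in> A" "0 \<notin> A"
    and nonneg: "\<And>d a. 0 \<le> f d a"
    and scale: "\<And>k d a. k > 0 \<Longrightarrow> f (k * d) (k * a) = f d a"
  shows "(\<Sum>q\<in>A. 1 / q * (\<Sum>l=1..q-1. f q l))
       \<le> (\<Sum>k\<in>A. 1 / k) * (\<Sum>d\<in>A - {1}. 1 / d * (\<Sum>a\<in>totatives d. f d a))"
proof -
  let ?S = "Sigma A (\<lambda>q. {1..q-1})"
  \<comment> \<open>With \<open>k = gcd q l\<close> and \<open>d = q div k\<close>, the weight
    \<open>1 / q\<close> splits as \<open>1 / k * (1 / d)\<close>. Enlarging the image of this map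
    to the full product set makes the bound factor.\<close>
  let ?\<phi> = "\<lambda>(q, l). (gcd q l, q div gcd q l, l div gcd q l) :: nat \<times> nat \<times> nat"
  let ?G = "\<lambda>(k, d, a). 1 / real k * (1 / real d * f d a)"
  have "inj_on ?\<phi> ?S"
  proof (rule inj_onI; clarify)
    fix q l q' l' :: nat
    assume "gcd q l = gcd q' l'" "q div gcd q l = q' div gcd q' l'" "l div gcd q l = l' div gcd q' l'"
    then show "q = q' \<and> l = l'"
      by (metis dvd_mult_div_cancel gcd_dvd1 gcd_dvd2)
  qed
  moreover have G\<phi>: "?G (?\<phi> (q, l)) = 1 / q * f q l" if "q \<in> A" for q l
  proof -
    have "q > 0" using that A(2) by (cases q) auto
    then have g: "gcd q l > 0" by simp
    have "f q l = f (gcd q l * (q div gcd q l)) (gcd q l * (l div gcd q l))" by simp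
    also have "\<dots> = f (q div gcd q l) (l div gcd q l)" using g by (rule scale)
    finally have "f q l = f (q div gcd q l) (l div gcd q l)" .
    moreover have "real q = real (gcd q l) * real (q div gcd q l)"
      by (metis dvd_mult_div_cancel gcd_dvd1 of_nat_mult)
    ultimately show ?thesis by simp
  qed
  moreover have "?\<phi> ` ?S \<subseteq> A \<times> Sigma (A - {1}) totatives"
  proof clarify
    fix q l assume q: "q \<in> A" and l: "l \<in> {1..q-1}"
    have q0: "q > 0" using q A(2) by (cases q) auto
    have "q div gcd q l \<noteq> 1"
    proof
      assume "q div gcd q l = 1"
      then have "q = gcd q l" by (metis dvd_mult_div_cancel gcd_dvd1 mult.right_neutral)
      then have "q dvd l" by (metis gcd_dvd2)
      with l show False by (auto dest!: dvd_imp_le)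
    qed
    moreover have "q div gcd q l \<in> A" "gcd q l \<in> A"
      using q A(1) by (metis dvd_mult_div_cancel dvd_triv_right gcd_dvd1) (use q A(1) in auto)
    moreover have "l div gcd q l \<in> totatives (q div gcd q l)"
      using l q0 div_gcd_coprime[of q l]
      by (auto simp: in_totatives_iff div_greater_zero_iff coprime_commute intro!: div_le_mono gcd_le2_nat)
    ultimately show "gcd q l \<in> A \<and> (q div gcd q l, l div gcd q l) \<in> Sigma (A - {1}) totatives"
      by auto
  qed
  ultimately have "(\<Sum>p\<in>?S. ?G (?\<phi> p)) \<le> (\<Sum>p\<in>A \<times> Sigma (A - {1}) totatives. ?G p)"
    using assms(1) nonneg by (subst sum.reindex[symmetric, unfolded o_def]) (auto intro!: sum_mono2)
  moreover have "(\<Sum>p\<in>?S. ?G (?\<phi> p)) = (\<Sum>q\<in>A. 1 / q * (\<Sum>l=1..q-1. f q l))"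
  proof -
    have "(\<Sum>p\<in>?S. ?G (?\<phi> p)) = (\<Sum>(q, l)\<in>?S. 1 / q * f q l)"
      using G\<phi> by (intro sum.cong refl) auto
    then show ?thesis
      using assms(1) by (simp add: sum.Sigma sum_distrib_left)
  qed
  moreover have "(\<Sum>p\<in>A \<times> Sigma (A - {1}) totatives. ?G p)
      = (\<Sum>k\<in>A. 1 / k) * (\<Sum>d\<in>A - {1}. 1 / d * (\<Sum>a\<in>totatives d. f d a))"
  proof -
    have eq: "(\<Sum>d\<in>A - {1}. 1 / d * (\<Sum>a\<in>totatives d. f d a))
        = (\<Sum>(d, a)\<in>Sigma (A - {1}) totatives. 1 / real d * f d a)"
      unfolding sum_distrib_left using assms(1) by (intro sum.Sigma) auto
    show ?thesis
      unfolding eq sum_product sum.cartesian_product by (simp add: case_prod_beta)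
  qed
  ultimately show ?thesis by simp
qed

lemma turn_scale: "k > 0 \<Longrightarrow> turn \<beta> (k * d) (k * x) = turn \<beta> d x"
  by (simp add: turn_def mult.left_commute[of 4])

section \<open>Analytic estimates\<close>

lemma power_minus_one_le:
  fixes x :: real
  assumes "0 \<le> x"
  shows "(1 + x) ^ n - 1 \<le> n * x * (1 + x) ^ n"
proof (induction n)
  case (Suc n)
  have "1 * x \<le> (1 + x) ^ Suc n * x"
    using assms by (intro mult_right_mono one_le_power) auto
  moreover have "(1 + x) * ((1 + x) ^ n - 1) \<le> (1 + x) * (n * x * (1 + x) ^ n)"
    using Suc assms by (intro mult_left_mono) auto
  ultimately show ?case
    by (simp add: algebra_simps)
qed simp

text \<open>The factor \<open>(3/2)\<^sup>t\<close> leaves room for the weight \<open>2\<^sup>-\<^sup>t\<close> that comes from \<open>1/d\<close>.\<close>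

lemma dyadic_block_estimate:
  fixes \<delta> :: real and t m :: nat
  assumes "0 < \<delta>" "\<delta> \<le> 1/2" "t > 0" "20 * real t \<le> \<delta> * m" "Suc L = 2 * t"
  defines "\<epsilon> \<equiv> exp (- \<delta> / 2) ^ (m div (2 * t))"
  shows "(1 + \<epsilon>) ^ L - 1 \<le> 128 * real t ^ 3 * (3/2) ^ t / (\<delta> * m)\<^sup>2"
proof -
  \<comment> \<open>Without rounding in \<open>m div (2 * t)\<close>, \<open>\<epsilon>\<close>
    would equal \<open>exp (- x)\<close>; rounding costs at most a factor
    \<open>exp (\<delta> / 2)\<close>.\<close>
  define x where "x = \<delta> * m / (4 * t)"
  have x: "5 \<le> x" using assms by (simp add: x_def field_simps)
  define k where "k = m div (2 * t)"
  have "m < (k + 1) * (2 * t)"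
    using assms(3) unfolding k_def by (metis div_less_iff_less_mult less_add_one mult_pos_pos zero_less_numeral)
  then have "real m < real ((k + 1) * (2 * t))"
    by (rule of_nat_less_iff[THEN iffD2])
  then have "real m / real (2 * t) - 1 \<le> k"
    using assms(3) by (simp add: field_simps)
  then have "\<delta> * (real m / real (2 * t) - 1) \<le> \<delta> * k"
    using assms(1) by (intro mult_left_mono) auto
  then have "- (\<delta> / 2) * k \<le> \<delta> / 2 - x"
    by (simp add: x_def algebra_simps)
  moreover have "\<epsilon> = exp (- (\<delta> / 2) * k)"
    by (simp add: \<epsilon>_def k_def mult.commute flip: exp_of_nat_mult)
  ultimately have "\<epsilon> \<le> exp (\<delta> / 2 - x)"
    by simp
  also have "\<dots> = exp (\<delta> / 2) * exp (- x)"
    by (simp flip: exp_add)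
  also have "\<dots> \<le> 2 * (2 / x\<^sup>2)"
  proof (intro mult_mono)
    have "exp (\<delta> / 2) \<le> 1 + \<delta> / 2 + (\<delta> / 2)\<^sup>2"
      using assms by (intro exp_bound) auto
    also have "\<dots> \<le> 1 + 1/4 + (1/4)\<^sup>2"
      using assms by (intro add_mono power_mono) auto
    finally show "exp (\<delta> / 2) \<le> 2" by (simp add: power2_eq_square)
    have "x\<^sup>2 / 2 \<le> exp x"
      using exp_lower_Taylor_quadratic[of x] x by simp
    then show "exp (- x) \<le> 2 / x\<^sup>2"
      using x by (simp add: exp_minus field_simps)
  qed auto
  finally have \<epsilon>: "\<epsilon> \<le> 4 / x\<^sup>2" by simp
  have "4 / x\<^sup>2 \<le> 4 / 5\<^sup>2"
    using x by (intro divide_left_mono power_mono mult_pos_pos) auto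
  with \<epsilon> have \<epsilon>5: "\<epsilon> \<le> 1/5" by simp
  have \<epsilon>0: "0 \<le> \<epsilon>" by (simp add: \<epsilon>_def)
  have "(1 + \<epsilon>) ^ L \<le> (1 + \<epsilon>) ^ (2 * t)"
    using assms(5) \<epsilon>0 by (intro power_increasing) auto
  then have "(1 + \<epsilon>) ^ L - 1 \<le> (1 + \<epsilon>) ^ (2 * t) - 1" by simp
  also have "\<dots> \<le> real (2 * t) * \<epsilon> * (1 + \<epsilon>) ^ (2 * t)"
    using \<epsilon>0 by (rule power_minus_one_le)
  \<comment> \<open>The linear factor \<open>\<epsilon>\<close> keeps its decay in \<open>x\<close>,
    while in the power \<open>\<epsilon> \<le> 1/5\<close> suffices, as
    \<open>(6/5)\<^sup>2 < 3/2\<close>.\<close>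
  also have "\<dots> \<le> real (2 * t) * (4 / x\<^sup>2) * (3/2) ^ t"
  proof (intro mult_mono \<epsilon>)
    have "(1 + \<epsilon>)\<^sup>2 \<le> (1 + 1/5)\<^sup>2"
      using \<epsilon>5 \<epsilon>0 by (intro power_mono) auto
    then have "(1 + \<epsilon>)\<^sup>2 \<le> 3/2" by (simp add: power2_eq_square)
    then show "(1 + \<epsilon>) ^ (2 * t) \<le> (3/2) ^ t"
      unfolding power_mult by (intro power_mono) auto
  qed (use \<epsilon>0 in auto)
  also have "\<dots> = 128 * real t ^ 3 * (3/2) ^ t / (\<delta> * m)\<^sup>2"
    using assms(3) by (simp add: x_def power2_eq_square power3_eq_cube)
  finally show ?thesis .
qed

lemma sum_inverse_le:
  assumes "A \<subseteq> {1..2 ^ m}"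
  shows "(\<Sum>k\<in>A. 1 / real k) \<le> 1 + real m"
proof -
  have "(\<Sum>k\<in>A. 1 / real k) \<le> (\<Sum>k\<in>{1..2 ^ m}. 1 / real k)"
    using assms by (intro sum_mono2) auto
  also have "\<dots> = harm (2 ^ m)"
    by (simp add: harm_def divide_inverse)
  also have "\<dots> \<le> 1 + ln (2 ^ m)"
  proof -
    \<comment> \<open>The sequence \<open>harm n - ln n\<close> decreases from its value 1 at
      \<open>n = 1\<close>.\<close>
    have "harm (Suc (2 ^ m - 1)) - ln (Suc (2 ^ m - 1)) \<le> harm (Suc 0) - ln (Suc 0)"
      using decseqD[OF decseq_harm_diff_ln, of 0 "2 ^ m - 1"] by simp
    then show ?thesis by (simp add: harm_def)
  qed
  also have "\<dots> \<le> 1 + real m * 1"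
    using ln_2_less_1 by (simp add: ln_realpow mult_left_le)
  finally show ?thesis by simp
qed

lemma summable_cube_geometric: "summable (\<lambda>t. real t ^ 3 * (3/4) ^ t)"
proof (rule summable_comparison_test_ev)
  have "eventually (\<lambda>t. real t ^ 3 * (3/4) ^ t \<le> (7/8) ^ t) sequentially"
    by real_asymp
  then show "eventually (\<lambda>t. norm (real t ^ 3 * (3/4) ^ t) \<le> (7/8) ^ t) sequentially"
    by simp
qed (auto intro: summable_geometric)

section \<open>Summation over dyadic ranges of denominators\<close>

lemma sum_reduced_le:
  fixes \<delta> :: real and m :: nat
  assumes "0 < \<delta>" "\<delta> \<le> 1/2" "m > 0"
    and A: "A \<subseteq> {d. 1 < d \<and> odd d \<and> real d < (2 ^ m) powr (\<delta> / 40)}" "finite A"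
  shows "(\<Sum>d\<in>A. 1 / d * (\<Sum>a\<in>totatives d. \<Prod>j<m. turn (exp (- \<delta> / 2)) d (a * 2 ^ j)))
       \<le> 512 * (\<Sum>t. real t ^ 3 * (3/4) ^ t) / (\<delta> * m)\<^sup>2"
proof -
  define \<beta> where "\<beta> = exp (- \<delta> / 2)"
  have \<beta>: "0 \<le> \<beta>" "\<beta> \<le> 1" using assms(1) by (auto simp: \<beta>_def)
  define F where "F d = (\<Sum>a\<in>totatives d. \<Prod>j<m. turn \<beta> d (a * 2 ^ j))" for d
  \<comment> \<open>\<open>D t\<close> collects the denominators with exactly \<open>t\<close>
    binary digits.\<close>
  define D where "D t = {d \<in> A. floorlog 2 d = t}" for t
  have block: "(\<Sum>d\<in>D t. 1 / d * F d) \<le> 512 / (\<delta> * m)\<^sup>2 * (real t ^ 3 * (3/4) ^ t)"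
    if t_in: "t \<in> floorlog 2 ` A" for t
  proof -
    obtain d0 where d0: "d0 \<in> A" "t = floorlog 2 d0" using t_in by auto
    have bounds: "2 ^ (t - 1) \<le> d" "d < 2 ^ t" "1 < d" "odd d" if "d \<in> D t" for d
      using that A(1) floorlog_bounds[of d 2] by (auto simp: D_def)
    have d0': "2 ^ (t - 1) \<le> d0" "d0 < 2 ^ t" "1 < d0" "real d0 < (2 ^ m) powr (\<delta> / 40)"
      using d0 A(1) bounds[of d0] by (auto simp: D_def)
    have "t \<noteq> 0" using d0'(2,3) by (cases "t = 0") auto
    moreover have "t \<noteq> 1" using d0'(2,3) by auto
    ultimately have t: "t \<ge> 2" by simp
    have "2 powr real (t - 1) \<le> real d0"
      using d0'(1) by (simp add: powr_realpow)
    also have "\<dots> < 2 powr (m * (\<delta> / 40))"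
      using d0'(4) by (simp add: powr_powr flip: powr_realpow)
    finally have "real (t - 1) < m * (\<delta> / 40)" by simp
    \<comment> \<open>Since \<open>t \<ge> 2\<close>, \<open>t \<le> 2 * (t - 1)\<close>; hence the
      exponent \<open>\<delta> / 40\<close> yields the constant 20.\<close>
    then have large: "20 * real t \<le> \<delta> * m"
      using t by (simp add: of_nat_diff mult.commute)
    obtain L where L: "Suc L = 2 * t" using t by (metis Suc_pred' mult_pos_pos zero_less_numeral less_le_trans)
    define k where "k = m div (2 * t)"
    have "\<delta> * m \<le> 1 * real m" using assms by (intro mult_right_mono) auto
    with large t have "real (2 * t) \<le> real m" by simp
    then have k: "k > 0" "k * Suc L \<le> m"
      using t by (simp_all add: k_def L div_greater_zero_iff)
    have "(\<Sum>d\<in>D t. 1 / d * F d) \<le> (\<Sum>d\<in>D t. 2 / 2 ^ t * (\<Sum>a\<in>totatives d. \<Prod>j<L. turn (\<beta> ^ k) d (a * 2 ^ j)))"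
    proof (intro sum_mono mult_mono)
      fix d assume d: "d \<in> D t"
      have "2 ^ t = 2 * 2 ^ (t - 1)" using t by (cases t) auto
      also have "\<dots> \<le> 2 * d" using bounds(1)[OF d] by simp
      finally have "real (2 ^ t) \<le> real (2 * d)" by (rule of_nat_mono)
      then show "1 / real d \<le> 2 / 2 ^ t"
        using bounds(3)[OF d] by (simp add: field_simps)
      show "F d \<le> (\<Sum>a\<in>totatives d. \<Prod>j<L. turn (\<beta> ^ k) d (a * 2 ^ j))"
        unfolding F_def using bounds[OF d] k \<beta> by (intro sum_orbit_le_sum_block)
      show "0 \<le> F d"
        unfolding F_def using \<beta> by (intro sum_nonneg prod_nonneg turn_nonneg)
    qed simp
    also have "\<dots> = 2 / 2 ^ t * (\<Sum>d\<in>D t. \<Sum>a\<in>totatives d. \<Prod>j<L. turn (\<beta> ^ k) d (a * 2 ^ j))"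
      by (simp add: sum_distrib_left)
    also have "\<dots> \<le> 2 / 2 ^ t * (2 * ((1 + \<beta> ^ k) ^ L - 1))"
      using bounds L \<beta> by (intro mult_left_mono sum_turns_fractions_le) auto
    also have "\<dots> \<le> 2 / 2 ^ t * (2 * (128 * real t ^ 3 * (3/2) ^ t / (\<delta> * m)\<^sup>2))"
      unfolding k_def \<beta>_def using t L large assms by (intro mult_left_mono dyadic_block_estimate) auto
    also have "\<dots> = 512 / (\<delta> * m)\<^sup>2 * (real t ^ 3 * ((3/2) ^ t / 2 ^ t))"
      by simp
    also have "(3/2) ^ t / 2 ^ t = (3/4 :: real) ^ t"
      by (simp flip: power_divide)
    finally show ?thesis .
  qed
  have "(\<Sum>d\<in>A. 1 / d * F d) = (\<Sum>t\<in>floorlog 2 ` A. \<Sum>d\<in>D t. 1 / d * F d)"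
    unfolding D_def using A(2) by (intro sum.group[symmetric]) auto
  also have "\<dots> \<le> (\<Sum>t\<in>floorlog 2 ` A. 512 / (\<delta> * m)\<^sup>2 * (real t ^ 3 * (3/4) ^ t))"
    by (intro sum_mono block)
  also have "\<dots> = 512 / (\<delta> * m)\<^sup>2 * (\<Sum>t\<in>floorlog 2 ` A. real t ^ 3 * (3/4) ^ t)"
    by (simp add: sum_distrib_left)
  also have "\<dots> \<le> 512 / (\<delta> * m)\<^sup>2 * (\<Sum>t. real t ^ 3 * (3/4) ^ t)"
    using A(2) by (intro mult_left_mono sum_le_suminf summable_cube_geometric) auto
  finally show ?thesis
    by (simp add: F_def \<beta>_def)
qed

section \<open>The sieving exponent\<close>

lemma sieving_exponent_linear:
  assumes "1/2 < \<rho>" "\<rho> < 1"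
  shows "sieving_exponent \<rho> ((1 - \<rho>) / 40)"
proof -
  define \<delta> where "\<delta> = 1 - \<rho>"
  have \<delta>: "0 < \<delta>" "\<delta> \<le> 1/2" using assms by (auto simp: \<delta>_def)
  define \<beta> where "\<beta> = exp (- \<delta> / 2)"
  define C where "C = (\<Sum>t. real t ^ 3 * (3/4) ^ t)"
  define S where "S m = (\<Sum>q | real q < (2 ^ m) powr (\<delta> / 40) \<and> odd q \<and> squarefree q. cmod (Rq \<rho> m q))" for m
  have bound: "norm (S m) \<le> (1 + real m) * (512 * C / (\<delta> * m)\<^sup>2)" if "m > 0" for m
  proof -
    define A where "A = {q. real q < (2 ^ m) powr (\<delta> / 40) \<and> odd q}"
    \<comment> \<open>An exponent of at most 1 keeps \<open>A\<close> inside
      \<open>{1..2 ^ m}\<close>, as the harmonic bound requires.\<close>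
    have "(2 ^ m) powr (\<delta> / 40) \<le> (2 ^ m :: real) powr 1"
      using \<delta> by (intro powr_mono) auto
    then have le: "(2 ^ m) powr (\<delta> / 40) \<le> (2 ^ m :: real)"
      by simp
    have "q \<in> {1..2 ^ m}" if "q \<in> A" for q
    proof -
      have "real q < 2 ^ m"
        using that le unfolding A_def mem_Collect_eq by linarith
      then have "q < 2 ^ m" by simp
      moreover have "q > 0" using that by (simp add: A_def odd_pos)
      ultimately show ?thesis by simp
    qed
    then have sub: "A \<subseteq> {1..2 ^ m}" by blast
    then have fin: "finite A" by (rule finite_subset) auto
    have div: "d \<in> A" if "q \<in> A" "d dvd q" for q d
    proof -
      have "d \<le> q" using that sub by (intro dvd_imp_le) auto
      with that show ?thesis by (auto simp: A_def)
    qed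
    let ?f = "\<lambda>d a. \<Prod>j<m. turn \<beta> d (a * 2 ^ j)"
    have "norm (S m) \<le> (\<Sum>q\<in>A. cmod (Rq \<rho> m q))"
      unfolding S_def using fin by (auto simp: A_def intro!: sum_mono2 sum_nonneg abs_of_nonneg[THEN ord_eq_le_trans])
    also have "\<dots> \<le> (\<Sum>q\<in>A. 1 / q * (\<Sum>l=1..q-1. ?f q l))"
      unfolding \<beta>_def \<delta>_def using assms sub by (intro sum_mono cmod_Rq_le) auto
    also have "\<dots> \<le> (\<Sum>k\<in>A. 1 / k) * (\<Sum>d\<in>A - {1}. 1 / d * (\<Sum>a\<in>totatives d. ?f d a))"
      using fin div sub
      by (intro sum_fractions_le_sum_reduced) (auto simp: turn_scale mult.assoc \<beta>_def intro!: prod_nonneg turn_nonneg)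
    also have "\<dots> \<le> (1 + real m) * (512 * C / (\<delta> * m)\<^sup>2)"
    proof (intro mult_mono)
      show "(\<Sum>k\<in>A. 1 / real k) \<le> 1 + real m"
        using sub by (rule sum_inverse_le)
      have "d > 1" if "d \<in> A - {1}" for d
        using that sub by (cases "d = 0") auto
      then show "(\<Sum>d\<in>A - {1}. 1 / d * (\<Sum>a\<in>totatives d. ?f d a)) \<le> 512 * C / (\<delta> * m)\<^sup>2"
        unfolding C_def \<beta>_def using \<delta> that fin by (intro sum_reduced_le) (auto simp: A_def)
    qed (auto simp: \<beta>_def intro!: sum_nonneg divide_nonneg_nonneg prod_nonneg turn_nonneg)
    finally show ?thesis .
  qed
  \<comment> \<open>For fixed \<open>\<delta>\<close> the harmonic factor is \<open>O(m)\<close> and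
    the other is \<open>O(1 / m\<^sup>2)\<close>, so the total is \<open>O(1 / m)\<close>.\<close>
  have "(\<lambda>m. (1 + real m) * (512 * C / (\<delta> * m)\<^sup>2)) \<longlonglongrightarrow> 0"
    using \<delta>(1) by real_asymp
  then have "S \<longlonglongrightarrow> 0"
    by (rule Lim_null_comparison[rotated]) (use bound in \<open>auto intro: eventually_mono[OF eventually_gt_at_top[of 0]]\<close>)
  then have "S \<in> o(\<lambda>_. 1)"
    by (intro smalloI_tendsto) auto
  then show ?thesis
    using \<delta>(1) unfolding sieving_exponent_def S_def \<delta>_def by simp
qed

theorem theorem1:
  shows "(\<forall>\<rho>::real. 1/2 < \<rho> \<and> \<rho> < 1 \<longrightarrow> (\<exists>\<alpha>>0. sieving_exponent \<rho> \<alpha>)) \<and>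
         (\<exists>c>0. \<forall>\<rho>::real. 1/2 < \<rho> \<and> \<rho> < 1 \<longrightarrow> sieving_exponent \<rho> (c * (1 - \<rho>)))"
proof
  show "\<forall>\<rho>::real. 1/2 < \<rho> \<and> \<rho> < 1 \<longrightarrow> (\<exists>\<alpha>>0. sieving_exponent \<rho> \<alpha>)"
  proof (intro allI impI)
    fix \<rho> :: real
    assume "1/2 < \<rho> \<and> \<rho> < 1"
    then show "\<exists>\<alpha>>0. sieving_exponent \<rho> \<alpha>"
      using sieving_exponent_linear[of \<rho>] by (intro exI[of _ "(1 - \<rho>) / 40"]) auto
  qed
  show "\<exists>c>0. \<forall>\<rho>::real. 1/2 < \<rho> \<and> \<rho> < 1 \<longrightarrow> sieving_exponent \<rho> (c * (1 - \<rho>))"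
    using sieving_exponent_linear by (intro exI[of _ "1 / 40"]) auto
qed

end
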